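(* For every integer $m$, \[ \sum_{n=1}^\infty \Big\lfloor\frac{n}{2}\Big\rfloor\frac{L_{n+m}}{2^n n}=-\frac{3\sqrt5}{4}F_m\log\alpha-\frac{L_m}{8}\log 5+\frac{L_{m+3}}{2} \] and \[ \sum_{n=1}^\infty \Big\lfloor\frac{n}{2}\Big\rfloor\frac{F_{n+m}}{2^n n}=-\frac{3}{4\sqrt5}L_m\log\alpha-\frac{F_m}{8}\log 5+\frac{F_{m+3}}{2}. \]
   Context: $F_n$ and $L_n$ are the Fibonacci and Lucas numbers: $F_0=0,F_1=1$, $L_0=2,L_1=1$, $F_n=F_{n-1}+F_{n-2}$, $L_n=L_{n-1}+L_{n-2}$, extended to all integers by $F_{-n}=(-1)^{n-1}F_n$, $L_{-n}=(-1)^nL_n$; equivalently $F_n=(\alpha^n-\beta^n)/(\alpha-\beta)$, $L_n=\alpha^n+\beta^n$ with $\alpha=(1+\sqrt5)/2$, $\beta=(1-\sqrt5)/2$. $\lfloor x\rfloor$ is the floor function and $\log$ the natural logarithm. *)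

theory Defs
  imports Complex_Main "HOL-Number_Theory.Fib"
begin

fun lucas :: "nat \<Rightarrow> nat" where
  "lucas 0 = 2"
| "lucas (Suc 0) = 1"
| "lucas (Suc (Suc n)) = lucas (Suc n) + lucas n"

text \<open>For negative indices: \<open>F(-n) = (-1)^(n-1) F(n)\<close> and \<open>L(-n) = (-1)^n L(n)\<close>.\<close>

definition fib_int :: "int \<Rightarrow> int" where
  "fib_int k = (if k \<ge> 0 then int (fib (nat k)) else (-1) ^ (nat (-k) - 1) * int (fib (nat (-k))))"

definition lucas_int :: "int \<Rightarrow> int" where
  "lucas_int k = (if k \<ge> 0 then int (lucas (nat k)) else (-1) ^ nat (-k) * int (lucas (nat (-k))))"

definition golden :: real where
  "golden = (1 + sqrt 5) / 2"

end

theory Submission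
  imports Defs "HOL-Analysis.Complex_Transcendental"
begin

text \<open>
  Since \<open>\<lfloor>n/2\<rfloor> = n/2 - (1 - (-1)^n)/4\<close>, the generating function
  \<open>\<Sum> \<lfloor>n/2\<rfloor> x^n/n\<close> is a geometric series plus two logarithmic series, with value
  \<open>x / (2 (1 - x)) - ln ((1 + x) / (1 - x)) / 4\<close>.
  At \<open>x = \<alpha>/2\<close> and \<open>x = \<beta>/2\<close> the quotient \<open>x / (1 - x)\<close> is \<open>\<alpha>^3\<close> and \<open>\<beta>^3\<close>, and
  \<open>(1 + x) / (1 - x)\<close> is \<open>\<surd>5 \<alpha>^3\<close> and \<open>\<surd>5 / \<alpha>^3\<close>. The Binet formulas combine the two values.
\<close>

definition golden_conj :: real where
  "golden_conj = (1 - sqrt 5) / 2"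

lemma golden_square: "golden\<^sup>2 = golden + 1"
  and golden_conj_square: "golden_conj\<^sup>2 = golden_conj + 1"
  by (simp_all add: golden_def golden_conj_def power2_eq_square field_simps)

lemma golden_mult_conj: "golden * golden_conj = -1"
  by (simp add: golden_def golden_conj_def field_simps)

text \<open>The upper bound puts \<open>golden / 2\<close> inside the interval of convergence of the
  series.\<close>

lemma golden_bounds: "1 < golden" "golden < 2"
proof -
  have "1 < sqrt 5" "sqrt 5 < 3"
    by (simp_all add: real_less_lsqrt)
  then show "1 < golden" "golden < 2"
    by (simp_all add: golden_def)
qed

lemma golden_conj_bounds: "-1 < golden_conj" "golden_conj < 0"
  using golden_bounds by (simp_all add: golden_def golden_conj_def)

lemma fib_binet: "real (fib n) = (golden ^ n - golden_conj ^ n) / sqrt 5"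
  unfolding golden_def golden_conj_def by (rule fib_closed_form)

lemma lucas_binet: "real (lucas n) = golden ^ n + golden_conj ^ n"
proof (induction n rule: lucas.induct)
  case (3 n)
  have "real (lucas (Suc (Suc n)))
      = golden ^ n * (golden + 1) + golden_conj ^ n * (golden_conj + 1)"
    using 3 by (simp add: algebra_simps)
  then show ?case
    by (simp flip: golden_square golden_conj_square add: power2_eq_square mult_ac)
qed (simp_all add: golden_def golden_conj_def field_simps)

text \<open>As the roots have product -1, the inverse of each is minus the other, so negating the
  exponent swaps them up to sign.\<close>

lemma golden_powi_minus:
  "golden powi (- int n) = (-1) ^ n * golden_conj ^ n"
  "golden_conj powi (- int n) = (-1) ^ n * golden ^ n"
proof -
  have "inverse golden = - golden_conj" "inverse golden_conj = - golden"
    using golden_mult_conj by (auto intro!: inverse_unique simp: mult.commute)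
  then show "golden powi (- int n) = (-1) ^ n * golden_conj ^ n"
    "golden_conj powi (- int n) = (-1) ^ n * golden ^ n"
    by (simp_all add: power_int_minus power_inverse [symmetric] power_mult_distrib [symmetric])
qed

lemma fib_int_binet:
  "real_of_int (fib_int k) = (golden powi k - golden_conj powi k) / sqrt 5"
proof (cases "k \<ge> 0")
  case True
  then show ?thesis
    using fib_binet [of "nat k"] by (simp add: fib_int_def power_int_def field_simps)
next
  case False
  \<comment> \<open>Writing \<open>Suc n\<close> turns the truncated \<open>nat (-k) - 1\<close> of
    \<open>fib_int\<close> into \<open>n\<close>. Swapping the roots negates their difference, which
    accounts for the exponent being one less than in \<open>lucas_int\<close>.\<close>
  then obtain n where k: "k = - int (Suc n)"
    by (metis int_cases not_le_imp_less negative_zle negD of_nat_Suc)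
  show ?thesis
    unfolding k golden_powi_minus
    using fib_binet [of "Suc n"] 
    by (cases "even n") (simp_all add: fib_int_def nat_add_distrib field_simps)
qed

lemma lucas_int_binet:
  "real_of_int (lucas_int k) = golden powi k + golden_conj powi k"
proof (cases "k \<ge> 0")
  case True
  then show ?thesis
    using lucas_binet [of "nat k"] by (simp add: lucas_int_def power_int_def)
next
  case False
  then obtain n where k: "k = - int n" "n > 0"
    by (metis not_le minus_minus neg_0_less_iff_less of_nat_0_less_iff pos_int_cases)
  then show ?thesis
    unfolding k(1) golden_powi_minus
    using lucas_binet [of n] by (simp add: lucas_int_def algebra_simps)
qed

lemma floor_half: "real_of_int \<lfloor>real n / 2\<rfloor> = real n / 2 - (1 - (-1) ^ n) / 4"
proof -
  have "\<lfloor>real n / 2\<rfloor> = int (n div 2)"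
    using floor_divide_of_nat_eq [of n 2] by simp
  then show ?thesis
    by (cases "even n") (auto elim!: evenE oddE simp: field_simps)
qed

lemma sums_floor_half:
  fixes x :: real
  assumes "\<bar>x\<bar> < 1"
  shows "(\<lambda>k. real_of_int \<lfloor>real (Suc k) / 2\<rfloor> * (x ^ Suc k / real (Suc k)))
           sums (x / (2 * (1 - x)) - ln ((1 + x) / (1 - x)) / 4)"
proof -
  \<comment> \<open>The part n/2 of the floor cancels the denominator n, leaving a geometric series
    that starts at x/2.\<close>
  have geo: "(\<lambda>k. x / 2 * x ^ k) sums (x / 2 * (1 / (1 - x)))"
    using assms by (intro sums_mult geometric_sums) simp
  \<comment> \<open>\<open>ln_series'\<close> starts at index 0, where division by zero makes the
    term 0, so the shift to \<open>Suc k\<close> keeps the sum.\<close>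
  have plus: "(\<lambda>k. - ((-x) ^ Suc k) / real (Suc k)) sums ln (1 + x)"
    using ln_series' [OF assms] by (subst sums_Suc_iff) simp
  have minus: "(\<lambda>k. - (x ^ Suc k) / real (Suc k)) sums ln (1 - x)"
    using ln_series' [of "-x"] assms by (subst sums_Suc_iff) simp
  have "(\<lambda>k. x / 2 * x ^ k - (- ((-x) ^ Suc k) / real (Suc k) - - (x ^ Suc k) / real (Suc k)) / 4)
      sums (x / 2 * (1 / (1 - x)) - (ln (1 + x) - ln (1 - x)) / 4)"
    by (intro sums_diff sums_divide geo plus minus)
  also have "(\<lambda>k. x / 2 * x ^ k - (- ((-x) ^ Suc k) / real (Suc k) - - (x ^ Suc k) / real (Suc k)) / 4)
      = (\<lambda>k. real_of_int \<lfloor>real (Suc k) / 2\<rfloor> * (x ^ Suc k / real (Suc k)))"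
    unfolding floor_half power_minus [of x] by (rule ext) (simp add: divide_simps, simp add: algebra_simps)
  also have "x / 2 * (1 / (1 - x)) - (ln (1 + x) - ln (1 - x)) / 4
      = x / (2 * (1 - x)) - ln ((1 + x) / (1 - x)) / 4"
    using assms by (subst ln_div) (auto simp: abs_less_iff)
  finally show ?thesis .
qed

text \<open>\<open>ln golden\<close> enters the two values with opposite signs. This is why F_m
  accompanies it in the Lucas sum and L_m in the Fibonacci sum.\<close>

lemma sums_floor_half_golden:
  "(\<lambda>k. real_of_int \<lfloor>real (Suc k) / 2\<rfloor> * ((golden / 2) ^ Suc k / real (Suc k)))
     sums (golden ^ 3 / 2 - ln 5 / 8 - 3 / 4 * ln golden)" (is "?A sums ?a")
  and sums_floor_half_golden_conj:
  "(\<lambda>k. real_of_int \<lfloor>real (Suc k) / 2\<rfloor> * ((golden_conj / 2) ^ Suc k / real (Suc k)))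
     sums (golden_conj ^ 3 / 2 - ln 5 / 8 + 3 / 4 * ln golden)" (is "?B sums ?b")
proof -
  have conj: "golden_conj = 1 - golden" "sqrt 5 = 2 * golden - 1"
    by (simp_all add: golden_def golden_conj_def field_simps)
  have pos: "golden > 0"
    using golden_bounds by simp
  have nz: "1 - golden / 2 \<noteq> 0" "1 - golden_conj / 2 \<noteq> 0" "golden ^ 3 \<noteq> 0"
    using golden_bounds golden_conj_bounds by simp_all
  \<comment> \<open>These rest on 2 - \<alpha> = 1/\<alpha>^2 and 2 + \<alpha> =
    \<open>sqrt 5\<close> \<alpha>, and their conjugates. Cleared of denominators and written in
    \<open>golden\<close> alone, they are polynomial consequences of
    \<open>golden_square\<close>.\<close>
  have eqs: "golden / 2 = golden ^ 3 * (1 - golden / 2)"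
       "golden_conj / 2 = golden_conj ^ 3 * (1 - golden_conj / 2)"
       "1 + golden / 2 = sqrt 5 * golden ^ 3 * (1 - golden / 2)"
       "(1 + golden_conj / 2) * golden ^ 3 = sqrt 5 * (1 - golden_conj / 2)"
    unfolding conj using golden_square by (simp_all add: field_simps) algebra+
  have quot: "(1 + golden / 2) / (1 - golden / 2) = sqrt 5 * golden ^ 3"
       "(1 + golden_conj / 2) / (1 - golden_conj / 2) = sqrt 5 / golden ^ 3"
    using eqs(3,4) nz by (metis nonzero_divide_eq_eq, metis frac_eq_eq)
  have "golden / 2 / (1 - golden / 2) = golden ^ 3"
       "golden_conj / 2 / (1 - golden_conj / 2) = golden_conj ^ 3"
    using eqs(1,2) nz by (metis nonzero_divide_eq_eq)+
  then have half: "golden / 2 / (2 * (1 - golden / 2)) = golden ^ 3 / 2"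
       "golden_conj / 2 / (2 * (1 - golden_conj / 2)) = golden_conj ^ 3 / 2"
    by (metis divide_divide_eq_left')+
  have "ln (sqrt 5 * golden ^ 3) = ln 5 / 2 + 3 * ln golden"
       "ln (sqrt 5 / golden ^ 3) = ln 5 / 2 - 3 * ln golden"
    using pos by (simp_all add: ln_mult ln_div ln_sqrt ln_realpow)
  then show "?A sums ?a" "?B sums ?b"
    using sums_floor_half [of "golden / 2"] sums_floor_half [of "golden_conj / 2"]
      golden_bounds golden_conj_bounds
    by (simp_all only: half quot) (simp_all add: diff_divide_distrib add_divide_distrib algebra_simps)
qed

theorem theorem3:
  fixes m :: int
  shows "((\<lambda>k. let n = Suc k in
            real_of_int \<lfloor>real n / 2\<rfloor> * (real_of_int (lucas_int (int n + m)) / (2 ^ n * real n)))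
          sums (- (3 * sqrt 5 / 4) * real_of_int (fib_int m) * ln golden
                - real_of_int (lucas_int m) / 8 * ln 5
                + real_of_int (lucas_int (m + 3)) / 2))
       \<and> ((\<lambda>k. let n = Suc k in
            real_of_int \<lfloor>real n / 2\<rfloor> * (real_of_int (fib_int (int n + m)) / (2 ^ n * real n)))
          sums (- (3 / (4 * sqrt 5)) * real_of_int (lucas_int m) * ln golden
                - real_of_int (fib_int m) / 8 * ln 5
                + real_of_int (fib_int (m + 3)) / 2))"
proof -
  define a where "a = golden powi m"
  define b where "b = golden_conj powi m"
  have nz: "golden \<noteq> 0" "golden_conj \<noteq> 0"
    using golden_bounds golden_conj_bounds by auto
  have shift: "golden powi (int n + m) = golden ^ n * a"
              "golden_conj powi (int n + m) = golden_conj ^ n * b" for n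
    using nz by (simp_all add: a_def b_def power_int_add)
  have shift3: "golden powi (m + 3) = golden ^ 3 * a"
               "golden_conj powi (m + 3) = golden_conj ^ 3 * b"
    using shift [of 3] by (simp_all add: add.commute)
  \<comment> \<open>The weights \<open>a\<close> and \<open>b\<close> raise the exponent n to n + m.
    Then A + B is the Lucas series, and (A - B) / \<open>sqrt 5\<close> the Fibonacci
    series.\<close>
  note A = sums_mult [OF sums_floor_half_golden, of a]
  note B = sums_mult [OF sums_floor_half_golden_conj, of b]
  note binet = lucas_int_binet fib_int_binet shift shift3 a_def [symmetric] b_def [symmetric]
  \<comment> \<open>This separates the comparison of the terms from that of the limits.\<close>
  have sums_trans: "g sums t" if "f sums s" "\<And>k. f k = g k" "s = t"
    for f g :: "nat \<Rightarrow> real" and s t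
    using that by (simp add: sums_def)
  show ?thesis
    unfolding Let_def binet
  proof (intro conjI, goal_cases)
    case 1
    show ?case
      by (rule sums_trans [OF sums_add [OF A B]])
         (simp_all add: power_divide field_simps, simp_all add: add_divide_distrib)
  next
    case 2
    show ?case
      by (rule sums_trans [OF sums_divide [OF sums_diff [OF A B], of "sqrt 5"]])
         (simp_all add: power_divide add_divide_distrib diff_divide_distrib algebra_simps)
  qed
qed

end
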